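(* Let the prior $P$ be the uniform distribution on $\mathcal{H}=\{h_1,\dots,h_H\}$, let $H'\in\{1,\dots,H\}$, and let posterior weights $q_1,\dots,q_{H'}\ge 0$ with $\sum_{j=1}^{H'}q_j=1$ be given. Let $\phi\in\{\mathrm{lin},\mathrm{sq},\mathrm{kl}\}$. Then among all subsets $\mathcal{H}'\subset\mathcal{H}$ of size $H'$, the smallest bound value $B_{\phi,\chi^2}(Q,\mathcal{H}')$ corresponding to the given posterior weights $Q=\{q_j\}_{j=1}^{H'}$ is achieved when $\mathcal{H}'$ is the subset formed by the first $H'$ elements of $\mathcal{H}$ ordered by non-decreasing empirical risk values $\hat l_1\le \hat l_2\le\dots\le\hat l_H$.
   Context: $\mathcal{H}=\{h_1,\dots,h_H\}$ is a finite set of classifiers with empirical risks $\hat l_1\le\dots\le\hat l_H$ in $[0,1]$; $m\ge1$ is an integer (sample size) and $\delta\in(0,1)$. For $\mathcal{H}'\subset\mathcal{H}$ of size $H'$ and weights $Q=\{q_j\}_{j=1}^{H'}$, list the elements of $\mathcal{H}'$ in order of non-decreasing empirical risk, as $h_{i_1},\dots,h_{i_{H'}}$ with $i_1<\dots<i_{H'}$; the weight $q_j$ is assigned to $h_{i_j}$. Put $\hat L(Q,\mathcal{H}')=\sum_{j=1}^{H'}\hat l_{i_j}q_j$ and $S=\sum_{j=1}^{H'}q_j^2$. The bounds (for uniform prior $p_i=1/H$) are $B_{\mathrm{lin},\chi^2}(Q,\mathcal{H}')=\hat L(Q,\mathcal{H}')+\sqrt{\frac{S\,H}{4m\delta}}$,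 $B_{\mathrm{sq},\chi^2}(Q,\mathcal{H}')=\hat L(Q,\mathcal{H}')+\sqrt[4]{H\,S\,\frac{12m-11}{16m^3\delta}}$, $B_{\mathrm{kl},\chi^2}(Q,\mathcal{H}')=\sup\left\{r\in(0,1): kl(\hat L(Q,\mathcal{H}'),r)\le\sqrt{\frac{H\,S\,\mathcal{I}^R_{\mathrm{kl}}(m,2)}{\delta}}\right\}$, where $kl(a,b)=a\ln\frac ab+(1-a)\ln\frac{1-a}{1-b}$ (with $0\ln 0=0$) and $\mathcal{I}^R_{\mathrm{kl}}(m,2)=\sup_{l\in[0,1]}\sum_{k=0}^m\binom mk l^k(1-l)^{m-k}\left(kl\left(\tfrac km,l\right)\right)^2$ (terms with zero binomial weight are taken to be $0$). *)

theory Defs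
  imports "HOL-Analysis.Analysis"
begin

text \<open>
  A finite family of classifiers is given by an enumeration \<open>h\<close> that is injective on \<open>{1..n}\<close>; a
  function \<open>l\<close> assigns to each classifier its empirical risk, and \<open>l (h i)\<close> is non-decreasing in \<open>i\<close>.
  Posterior weights are \<open>q 1, \<dots>, q (card A)\<close> for a subfamily \<open>A \<subseteq> h ` {1..n}\<close>.
\<close>

text \<open>\<open>sub_index h n A j\<close> is the index \<open>i\<^sub>j\<close> where \<open>A = {h i\<^sub>1, h i\<^sub>2, \<dots>}\<close> and \<open>i\<^sub>1 < i\<^sub>2 < \<dots>\<close>; \<open>j\<close> counts from 1.\<close>

definition sub_index :: "(nat \<Rightarrow> 'h) \<Rightarrow> nat \<Rightarrow> 'h set \<Rightarrow> nat \<Rightarrow> nat" where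
  "sub_index h n A j = sorted_list_of_set {i \<in> {1..n}. h i \<in> A} ! (j - 1)"

definition emp_loss ::
  "(nat \<Rightarrow> 'h) \<Rightarrow> ('h \<Rightarrow> real) \<Rightarrow> nat \<Rightarrow> (nat \<Rightarrow> real) \<Rightarrow> 'h set \<Rightarrow> real" where
  "emp_loss h l n q A = (\<Sum>j = 1..card A. l (h (sub_index h n A j)) * q j)"

definition sq_weight :: "(nat \<Rightarrow> real) \<Rightarrow> 'h set \<Rightarrow> real" where
  "sq_weight q A = (\<Sum>j = 1..card A. (q j)\<^sup>2)"

text \<open>
  The convention \<open>0 ln 0 = 0\<close> holds automatically. Where the divergence should be infinite
  (\<open>b = 0 < a\<close> or \<open>a < 1 = b\<close>) this real-valued version has a meaningless finite value; below, that
  case arises only under a zero binomial weight.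
\<close>

definition kl :: "real \<Rightarrow> real \<Rightarrow> real" where
  "kl a b = a * ln (a / b) + (1 - a) * ln ((1 - a) / (1 - b))"

definition I_kl :: "nat \<Rightarrow> real" where
  "I_kl m = (SUP t\<in>{0..1}. \<Sum>k = 0..m.
      real (m choose k) * t ^ k * (1 - t) ^ (m - k) * (kl (real k / real m) t)\<^sup>2)"

datatype bound_kind = Lin | Sq | Kl

text \<open>The factor \<open>real n\<close> is the reciprocal of the uniform prior mass \<open>1 / n\<close>.\<close>

fun chi2_bound ::
  "bound_kind \<Rightarrow> nat \<Rightarrow> real \<Rightarrow> (nat \<Rightarrow> 'h) \<Rightarrow> ('h \<Rightarrow> real) \<Rightarrow> nat \<Rightarrow> (nat \<Rightarrow> real) \<Rightarrow> 'h set \<Rightarrow> real" where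
  "chi2_bound Lin m \<delta> h l n q A =
     emp_loss h l n q A + sqrt (sq_weight q A * real n / (4 * real m * \<delta>))"
| "chi2_bound Sq m \<delta> h l n q A =
     emp_loss h l n q A
       + root 4 (real n * sq_weight q A * ((12 * real m - 11) / (16 * real m ^ 3 * \<delta>)))"
| "chi2_bound Kl m \<delta> h l n q A =
     Sup {r \<in> {0<..<1}. kl (emp_loss h l n q A) r
                          \<le> sqrt (real n * sq_weight q A * I_kl m / \<delta>)}"

end

theory Submission
  imports Defs
begin

text \<open>
  All subfamilies of the same size share the weights, hence the same complexity term; each of the
  three bounds therefore depends on the subfamily only through its empirical loss, and it is
  non-decreasing in that loss. The loss itself is least for the initial segment: the \<open>j\<close>-th smallest
  index of any subfamily is at least \<open>j\<close> (\<open>sub_index_ge\<close>), so every risk occurring in the loss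
  dominates, weight by weight, the corresponding risk of the initial segment (\<open>emp_loss_initial_le\<close>).

  Monotonicity is evident for the linear and the square bound. For the kl bound, let \<open>a \<le> a'\<close> and let
  \<open>r\<close> satisfy \<open>kl a r \<le> c\<close>. If \<open>a' \<le> r\<close>, then \<open>kl a' r \<le> kl a r\<close>, because \<open>kl\<close> decreases as its
  first argument approaches the second (\<open>kl_antimono_left\<close>); so \<open>r\<close> is feasible for \<open>a'\<close> as well. If
  \<open>r < a'\<close>, then some feasible point for \<open>a'\<close> lies above \<open>r\<close>, namely \<open>a'\<close> itself, or a point close
  enough to 1 if \<open>a' = 1\<close>. Hence the supremum grows (\<open>kl_upper_inverse_mono\<close>).

  The delicate point is that the feasible set is empty for \<open>c = 0\<close> and \<open>a \<in> {0, 1}\<close>, where its supremum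
  is arbitrary. It has to be shown that \<open>c > 0\<close>, that is \<open>I_kl m > 0\<close>. As \<open>I_kl m\<close> is a supremum of
  reals, this requires its defining family to be bounded; the bound comes from the fact that the
  binomial weights decay like \<open>exp (- m * kl (k / m) t)\<close>, which beats the squared divergence.
\<close>

section \<open>Binary relative entropy\<close>

lemma mult_ln_divide_ge_diff:
  fixes a b :: real
  assumes "0 \<le> a" "0 < b"
  shows "a - b \<le> a * ln (a / b)"
proof (cases "a = 0")
  case False
  with assms have a: "a > 0" by simp
  have "ln (b / a) \<le> b / a - 1"
    using a assms by (intro ln_le_minus_one) simp
  then have "a * ln (b / a) \<le> a * (b / a - 1)"
    using a by (intro mult_left_mono) auto
  moreover have "a * (b / a - 1) = b - a"
    using a by (simp add: field_simps)
  moreover have "ln (b / a) = - ln (a / b)"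
    using a assms by (simp add: ln_div)
  ultimately show ?thesis by simp
qed (use assms in simp)

lemma kl_nonneg:
  assumes "a \<in> {0..1}" "b \<in> {0<..<1}"
  shows "kl a b \<ge> 0"
  using mult_ln_divide_ge_diff[of a b] mult_ln_divide_ge_diff[of "1 - a" "1 - b"] assms
  unfolding kl_def by auto

lemma kl_self: "kl a a = 0"
  unfolding kl_def by (cases "a = 0"; cases "a = 1") auto

lemma kl_0_left: "kl 0 r = ln (1 / (1 - r))"
  by (simp add: kl_def)

lemma kl_1_left: "kl 1 r = ln (1 / r)"
  by (simp add: kl_def)

text \<open>The three-point identity of the Bregman divergence generated by the negative entropy.\<close>

lemma kl_three_point:
  assumes "a \<in> {0..1}" "b \<in> {0<..<1}" "r \<in> {0<..<1}"
  shows "kl a r = kl a b + kl b r + (a - b) * (ln (b / r) - ln ((1 - b) / (1 - r)))"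
proof -
  have 1: "a * ln (a / r) = a * ln (a / b) + a * ln (b / r)"
    using assms by (cases "a = 0") (auto simp: ln_div algebra_simps)
  have 2: "(1 - a) * ln ((1 - a) / (1 - r))
      = (1 - a) * ln ((1 - a) / (1 - b)) + (1 - a) * ln ((1 - b) / (1 - r))"
    using assms by (cases "a = 1") (auto simp: ln_div algebra_simps)
  show ?thesis
    unfolding kl_def 1 2 by (simp add: algebra_simps)
qed

text \<open>
  In the three-point identity through \<open>b\<close>, both \<open>kl a b\<close> and the product term are nonnegative when
  \<open>b\<close> lies between \<open>a\<close> and \<open>r\<close>.
\<close>

lemma kl_antimono_left:
  assumes "0 \<le> a" "a \<le> b" "b \<le> r" "r \<in> {0<..<1}"
  shows "kl b r \<le> kl a r"
proof (cases "b = 0")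
  case False
  with assms have b: "b \<in> {0<..<1}" by auto
  have "ln (b / r) \<le> 0"
    using assms b by simp
  moreover have "ln ((1 - b) / (1 - r)) \<ge> 0"
    using assms b by simp
  ultimately have "(a - b) * (ln (b / r) - ln ((1 - b) / (1 - r))) \<ge> 0"
    using assms(2) by (intro mult_nonpos_nonpos) linarith+
  moreover have "kl a b \<ge> 0"
    using assms b by (intro kl_nonneg) auto
  ultimately show ?thesis
    using kl_three_point[of a b r] assms b by auto
qed (use assms in simp)

text \<open>
  Strict positivity of \<open>c\<close> is what makes the feasible set nonempty at \<open>a = 0\<close> and \<open>a = 1\<close>.
\<close>

lemma kl_upper_inverse_mono:
  assumes "0 \<le> a" "a \<le> b" "b \<le> 1" "0 < c"
  shows "Sup {r \<in> {0<..<1}. kl a r \<le> c} \<le> Sup {r \<in> {0<..<1}. kl b r \<le> c}"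
proof (rule cSup_mono)
  consider "a = 0" | "a = 1" | "a \<in> {0<..<1}"
    using assms by fastforce
  then show "{r \<in> {0<..<1}. kl a r \<le> c} \<noteq> {}"
  proof cases
    case 1
    have "1 - exp (- c) \<in> {r \<in> {0<..<1}. kl a r \<le> c}"
      using 1 assms by (simp add: kl_0_left ln_div)
    then show ?thesis by blast
  next
    case 2
    have "exp (- c) \<in> {r \<in> {0<..<1}. kl a r \<le> c}"
      using 2 assms by (simp add: kl_1_left ln_div)
    then show ?thesis by blast
  next
    case 3
    then have "a \<in> {r \<in> {0<..<1}. kl a r \<le> c}"
      using assms by (simp add: kl_self)
    then show ?thesis by blast
  qed
  show "bdd_above {r \<in> {0<..<1}. kl b r \<le> c}"
    by (rule bdd_aboveI[of _ 1]) auto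
  fix r
  assume r: "r \<in> {r \<in> {0<..<1}. kl a r \<le> c}"
  consider "b \<le> r" | "r < b" "b < 1" | "b = 1"
    using assms by linarith
  then show "\<exists>y \<in> {r \<in> {0<..<1}. kl b r \<le> c}. r \<le> y"
  proof cases
    case 1
    then have "kl b r \<le> kl a r"
      using assms r by (intro kl_antimono_left) auto
    with r show ?thesis by (intro bexI[of _ r]) auto
  next
    case 2
    with r assms show ?thesis by (intro bexI[of _ b]) (auto simp: kl_self)
  next
    case 3
    \<comment> \<open>Since \<open>kl 1 x = - ln x\<close>, every \<open>x \<ge> exp (- c)\<close> is feasible.\<close>
    define x where "x = max r (exp (- c))"
    have x: "0 < x" "x < 1" "r \<le> x"
      using r assms by (auto simp: x_def)
    have "ln (exp (- c)) \<le> ln x"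
      using x by (subst ln_le_cancel_iff) (auto simp: x_def)
    with x 3 show ?thesis
      by (intro bexI[of _ x]) (auto simp: kl_1_left ln_div)
  qed
qed

section \<open>Positivity of the binomial moment of the squared divergence\<close>

text \<open>With \<open>a = k / m \<le> 1\<close>, the right-hand side is \<open>(t / a) ^ k\<close>, and it is 1 if \<open>k = 0\<close>.\<close>

lemma power_le_exp_mult_ln_divide:
  fixes t :: real
  assumes "0 < t" "k \<le> m" "m \<ge> 1"
  shows "t ^ k \<le> exp (- (real m * (real k / real m * ln (real k / real m / t))))"
proof (cases "k = 0")
  case False
  define a where "a = real k / real m"
  have a: "0 < a" "a \<le> 1" and m: "real m * a = real k"
    using False assms by (auto simp: a_def)
  have "exp (- (real m * (a * ln (a / t)))) = exp (real k * ln (t / a))"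
    using a assms by (simp add: ln_div m[symmetric] algebra_simps)
  also have "\<dots> = (t / a) ^ k"
    using a assms by (simp add: exp_of_nat_mult)
  also have "\<dots> \<ge> t ^ k"
    using a assms by (intro power_mono) (auto simp: field_simps)
  finally show ?thesis by (simp add: a_def)
qed simp

text \<open>
  The Chernoff bound for a single outcome: with \<open>a = k / m\<close>, the weight equals
  \<open>a ^ k * (1 - a) ^ (m - k) * exp (- m * kl a t)\<close>, whose first two factors are at most 1.
\<close>

lemma binomial_weight_le_exp_kl:
  fixes t :: real
  assumes "t \<in> {0<..<1}" "k \<le> m" "m \<ge> 1"
  shows "t ^ k * (1 - t) ^ (m - k) \<le> exp (- (real m * kl (real k / real m) t))"
proof -
  have compl: "real (m - k) / real m = 1 - real k / real m"
    using assms by (simp add: of_nat_diff field_simps)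
  have "t ^ k * (1 - t) ^ (m - k)
      \<le> exp (- (real m * (real k / real m * ln (real k / real m / t))))
        * exp (- (real m * (real (m - k) / real m * ln (real (m - k) / real m / (1 - t)))))"
    using assms by (intro mult_mono power_le_exp_mult_ln_divide) auto
  also have "\<dots> = exp (- (real m * kl (real k / real m) t))"
    unfolding compl kl_def exp_add[symmetric] by (simp add: algebra_simps)
  finally show ?thesis .
qed

lemma power2_le_2_exp:
  fixes y :: real
  assumes "y \<ge> 0"
  shows "y\<^sup>2 \<le> 2 * exp y"
  using exp_lower_Taylor_quadratic[OF assms] assms by simp

text \<open>
  Inside the interval this is \<open>y\<^sup>2 * exp (- m * y) \<le> 2\<close> for \<open>y = kl (k / m) t\<close>; at the end points either
  the weight or the divergence vanishes.
\<close>

lemma binomial_weight_kl_squared_le: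
  fixes t :: real
  assumes "t \<in> {0..1}" "k \<le> m" "m \<ge> 1"
  shows "t ^ k * (1 - t) ^ (m - k) * (kl (real k / real m) t)\<^sup>2 \<le> 2"
proof -
  consider "t = 0" | "t = 1" | "t \<in> {0<..<1}"
    using assms by fastforce
  then show ?thesis
  proof cases
    case 1
    then show ?thesis by (cases "k = 0") (auto simp: kl_self zero_power)
  next
    case 2
    with assms show ?thesis by (cases "k = m") (auto simp: kl_self zero_power)
  next
    case 3
    define y where "y = kl (real k / real m) t"
    have y: "y \<ge> 0"
      unfolding y_def using assms 3 by (intro kl_nonneg) auto
    have "t ^ k * (1 - t) ^ (m - k) \<le> exp (- (real m * y))"
      unfolding y_def using assms 3 by (intro binomial_weight_le_exp_kl)
    also have "\<dots> \<le> exp (- y)"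
      using y assms mult_right_mono[of 1 "real m" y] by simp
    finally have "t ^ k * (1 - t) ^ (m - k) * y\<^sup>2 \<le> exp (- y) * (2 * exp y)"
      using y by (intro mult_mono power2_le_2_exp) auto
    also have "\<dots> = 2"
      by (simp add: exp_minus)
    finally show ?thesis by (simp add: y_def)
  qed
qed

text \<open>
  The family under the supremum is bounded, and its member at \<open>t = 1/2\<close> is positive already because of
  the outcome \<open>k = 0\<close>.
\<close>

lemma I_kl_pos:
  assumes "m \<ge> 1"
  shows "I_kl m > 0"
proof -
  define f where "f t = (\<Sum>k = 0..m.
      real (m choose k) * t ^ k * (1 - t) ^ (m - k) * (kl (real k / real m) t)\<^sup>2)" for t
  have "f t \<le> (\<Sum>k = 0..m. real (m choose k) * 2)" if "t \<in> {0..1}" for t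
    unfolding f_def mult.assoc
    using binomial_weight_kl_squared_le[OF that _ assms]
    by (intro sum_mono mult_left_mono) (auto simp: mult.assoc)
  then have "bdd_above (f ` {0..1})"
    by (intro bdd_aboveI2)
  then have "f (1 / 2) \<le> I_kl m"
    unfolding I_kl_def f_def[symmetric] by (intro cSUP_upper) auto
  moreover have "f (1 / 2) > 0"
    unfolding f_def
  proof (rule sum_pos2[where i = 0])
    show "0 < real (m choose 0) * (1 / 2) ^ 0 * (1 - 1 / 2) ^ (m - 0)
        * (kl (real 0 / real m) (1 / 2))\<^sup>2"
      by (simp add: kl_0_left)
  qed auto
  ultimately show ?thesis by simp
qed

section \<open>Empirical losses of subfamilies\<close>

lemma sorted_wrt_less_nth_ge:
  fixes xs :: "nat list"
  assumes "sorted_wrt (<) xs" "\<And>x. x \<in> set xs \<Longrightarrow> 1 \<le> x" "k < length xs"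
  shows "Suc k \<le> xs ! k"
  using assms(3)
proof (induction k)
  case 0
  then show ?case using assms(2)[of "xs ! 0"] by simp
next
  case (Suc k)
  then have "xs ! k < xs ! Suc k"
    using assms(1) by (intro sorted_wrt_nth_less) auto
  with Suc show ?case by simp
qed

lemma card_index_set:
  assumes "inj_on h {1..n}" "A \<subseteq> h ` {1..n}"
  shows "card {i \<in> {1..n}. h i \<in> A} = card A"
proof -
  have "inj_on h {i \<in> {1..n}. h i \<in> A}"
    using assms(1) by (rule inj_on_subset) auto
  moreover have "h ` {i \<in> {1..n}. h i \<in> A} = A"
    using assms(2) by auto
  ultimately show ?thesis by (metis card_image)
qed

lemma sub_index_in_range:
  assumes "inj_on h {1..n}" "A \<subseteq> h ` {1..n}" "j \<in> {1..card A}"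
  shows "sub_index h n A j \<in> {1..n}"
proof -
  let ?I = "{i \<in> {1..n}. h i \<in> A}"
  have "sorted_list_of_set ?I ! (j - 1) \<in> set (sorted_list_of_set ?I)"
    using assms card_index_set[OF assms(1,2)] by (intro nth_mem) auto
  then show ?thesis by (simp add: sub_index_def)
qed

lemma sub_index_ge:
  assumes "inj_on h {1..n}" "A \<subseteq> h ` {1..n}" "j \<in> {1..card A}"
  shows "j \<le> sub_index h n A j"
proof -
  let ?I = "{i \<in> {1..n}. h i \<in> A}"
  have "Suc (j - 1) \<le> sorted_list_of_set ?I ! (j - 1)"
    using assms card_index_set[OF assms(1,2)]
    by (intro sorted_wrt_less_nth_ge) (auto simp: strict_sorted_list_of_set)
  with assms(3) show ?thesis by (simp add: sub_index_def)
qed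

lemma sub_index_initial:
  assumes "inj_on h {1..n}" "n' \<le> n" "j \<in> {1..n'}"
  shows "sub_index h n (h ` {1..n'}) j = j"
proof -
  have "{i \<in> {1..n}. h i \<in> h ` {1..n'}} = {1..<Suc n'}"
    using assms(2) by (auto dest!: inj_onD[OF assms(1)])
  then have "sub_index h n (h ` {1..n'}) j = [1..<Suc n'] ! (j - 1)"
    unfolding sub_index_def by (simp only: sorted_list_of_set_range)
  also have "\<dots> = j"
    using assms(3) by (subst nth_upt) auto
  finally show ?thesis .
qed

lemma card_initial:
  assumes "inj_on h {1..n}" "n' \<le> n"
  shows "card (h ` {1..n'}) = n'"
  using assms by (subst card_image) (auto intro: inj_on_subset)

lemma emp_loss_initial_le:
  assumes "inj_on h {1..n}" "mono_on {1..n} (\<lambda>i. l (h i))" "A \<subseteq> h ` {1..n}"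
    and "\<And>j. j \<in> {1..card A} \<Longrightarrow> q j \<ge> 0" "card A \<le> n"
  shows "emp_loss h l n q (h ` {1..card A}) \<le> emp_loss h l n q A"
  unfolding emp_loss_def card_initial[OF assms(1,5)]
proof (rule sum_mono)
  fix j
  assume j: "j \<in> {1..card A}"
  have "l (h j) \<le> l (h (sub_index h n A j))"
    using mono_onD[OF assms(2), of j "sub_index h n A j"] j assms(5)
      sub_index_in_range[OF assms(1,3) j] sub_index_ge[OF assms(1,3) j] by auto
  then show "l (h (sub_index h n (h ` {1..card A}) j)) * q j
      \<le> l (h (sub_index h n A j)) * q j"
    using assms(4)[OF j] sub_index_initial[OF assms(1,5) j] by (simp add: mult_right_mono)
qed

lemma emp_loss_in_unit_interval:
  assumes "inj_on h {1..n}" "\<And>i. i \<in> {1..n} \<Longrightarrow> l (h i) \<in> {0..1}" "A \<subseteq> h ` {1..n}"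
    and "\<And>j. j \<in> {1..card A} \<Longrightarrow> q j \<ge> 0" "(\<Sum>j = 1..card A. q j) = 1"
  shows "emp_loss h l n q A \<in> {0..1}"
proof -
  have risk: "l (h (sub_index h n A j)) \<in> {0..1}" if "j \<in> {1..card A}" for j
    using assms(2) sub_index_in_range[OF assms(1,3) that] .
  have "0 \<le> emp_loss h l n q A"
    unfolding emp_loss_def using risk assms(4) by (intro sum_nonneg mult_nonneg_nonneg) auto
  moreover have "emp_loss h l n q A \<le> (\<Sum>j = 1..card A. q j)"
    unfolding emp_loss_def
  proof (rule sum_mono)
    fix j
    assume j: "j \<in> {1..card A}"
    then show "l (h (sub_index h n A j)) * q j \<le> q j"
      using risk[OF j] assms(4)[OF j] by (intro mult_left_le_one_le) auto
  qed
  ultimately show ?thesis using assms(5) by simp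
qed

lemma sq_weight_pos:
  assumes "(\<Sum>j = 1..card A. q j) = 1"
  shows "sq_weight q A > 0"
proof -
  obtain j where j: "j \<in> {1..card A}" "q j \<noteq> 0"
    using assms by (metis sum.neutral zero_neq_one)
  then show ?thesis
    unfolding sq_weight_def by (intro sum_pos2[where i = j]) auto
qed

section \<open>Optimality of the initial segment\<close>

theorem theorem2:
  fixes h :: "nat \<Rightarrow> 'h" and l :: "'h \<Rightarrow> real" and n n' m :: nat
    and q :: "nat \<Rightarrow> real" and \<delta> :: real and \<phi> :: bound_kind
  assumes "inj_on h {1..n}"
    and "\<And>i. i \<in> {1..n} \<Longrightarrow> l (h i) \<in> {0..1}"
    and "mono_on {1..n} (\<lambda>i. l (h i))"
    and "m \<ge> 1"
    and "\<delta> \<in> {0<..<1}"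
    and "n' \<in> {1..n}"
    and "\<And>j. j \<in> {1..n'} \<Longrightarrow> q j \<ge> 0"
    and "(\<Sum>j = 1..n'. q j) = 1"
  shows "is_arg_min (chi2_bound \<phi> m \<delta> h l n q)
           (\<lambda>A. A \<subseteq> h ` {1..n} \<and> card A = n') (h ` {1..n'})"
proof -
  let ?B = "h ` {1..n'}"
  have n': "1 \<le> n'" "n' \<le> n"
    using assms(6) by auto
  have B: "?B \<subseteq> h ` {1..n}" "card ?B = n'"
    using n' card_initial[OF assms(1) n'(2)] by auto
  have "chi2_bound \<phi> m \<delta> h l n q ?B \<le> chi2_bound \<phi> m \<delta> h l n q A"
    if A: "A \<subseteq> h ` {1..n}" "card A = n'" for A
  proof -
    have S: "sq_weight q ?B = sq_weight q A"
      by (simp only: sq_weight_def A B)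
    have L: "emp_loss h l n q ?B \<le> emp_loss h l n q A"
      using emp_loss_initial_le[OF assms(1,3) A(1), of q] A(2) assms(7) n' by simp
    show ?thesis
    proof (cases \<phi>)
      case Lin
      with L S show ?thesis by simp
    next
      case Sq
      with L S show ?thesis by simp
    next
      case Kl
      have "emp_loss h l n q ?B \<in> {0..1}" "emp_loss h l n q A \<in> {0..1}"
        using emp_loss_in_unit_interval[where h = h and l = l, OF assms(1,2)] A B assms(7,8) by simp_all
      moreover have "sq_weight q A > 0"
        using A(2) assms(8) by (intro sq_weight_pos) simp
      then have "sqrt (real n * sq_weight q A * I_kl m / \<delta>) > 0"
        using I_kl_pos[OF assms(4)] assms(5) n' by simp
      ultimately show ?thesis
        unfolding Kl chi2_bound.simps S using L by (intro kl_upper_inverse_mono) auto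
    qed
  qed
  with B show ?thesis
    unfolding is_arg_min_def by (metis not_le)
qed

end
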